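(* Let $\Gamma=(V,E)$ be an infinite weighted graph, $x_0\in V$, $r\ge1$ an integer, and let $B(x_0,r)=\{x\in V:d(x_0,x)\le r\}$. Put $l:=\sup_{x\in B(x_0,r)\setminus\{x_0\}}\frac{\mu(x)}{\mu_-(x)}$ and suppose $2\le l<\infty$. Then $$\lambda_{\mathrm{max}}(B(x_0,r))\ge\lambda_{\mathrm{max}}(V_l(r))-2\kappa(x_0,r),$$ where $V_l(r)$ is the ball of radius $r$ centered at $0$ in the weighted half-line $R_l$ and $\kappa(x_0,r):=\sup_{x\in B(x_0,r)}\frac{\mu_0(x)}{\mu(x)}$.
   Context: $\Gamma=(V,E)$ is a locally finite, connected graph with infinitely many vertices, equipped with symmetric edge weights $\mu_{xy}=\mu_{yx}\ge 0$, where $\mu_{xy}>0$ iff $(x,y)\in E$ (written $x\sim y$); self-loops ($\mu_{xx}>0$) are allowed. Put $\mu(x)=\sum_{y\in V}\mu_{xy}$, and let $d$ be the graph distance. With respect to the fixed reference vertex $x_0$, $\mu_-(x)=\sum\mu_{xy}$ over $y\sim x$ with $d(x_0,y)=d(x_0,x)-1$, and $\mu_0(x)=\sum\mu_{xy}$ over $y\sim x$ with $d(x_0,y)=d(x_0,x)$ (including $y=x$ if there is a self-loop at $x$). For a finite subset $\Omega$ of a weighted graph, the Dirichlet Laplace operator acts on real functions on $\Omega$ by $\Delta_\Omega f(x)=f(x)-\frac{1}{\mu(x)}\sum_{y\in\Omega}\mu_{xy}f(y)$, $x\in\Omega$ (with $\mu(x)$ the degree in the whole graph), and $\lambda_{\mathrm{max}}(\Omega)$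 is its largest eigenvalue. For real $l\ge2$, the weighted half-line $R_l$ has vertex set $\{0,1,2,\dots\}$, edges $(i,i+1)$, $i\ge0$, with weights $\mu_{i,i+1}=(l-1)^i$; $V_l(r)=\{0,1,\dots,r\}$. *)

theory Defs
  imports Complex_Main
begin

text \<open>
  A weighted graph is given by a vertex set \<open>V\<close> and a weight function \<open>\<mu>\<close>, of which only the
  values on \<open>V \<times> V\<close> matter. The edges are the pairs of positive weight, so a self-loop at \<open>x\<close>
  is present iff \<open>\<mu> x x > 0\<close>.
\<close>

definition edges :: "'v set \<Rightarrow> ('v \<Rightarrow> 'v \<Rightarrow> real) \<Rightarrow> ('v \<times> 'v) set" where
  "edges V \<mu> = {(x, y). x \<in> V \<and> y \<in> V \<and> \<mu> x y > 0}"

definition neighbours :: "'v set \<Rightarrow> ('v \<Rightarrow> 'v \<Rightarrow> real) \<Rightarrow> 'v \<Rightarrow> 'v set" where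
  "neighbours V \<mu> x = {y. (x, y) \<in> edges V \<mu>}"

locale weighted_graph =
  fixes V :: "'v set" and \<mu> :: "'v \<Rightarrow> 'v \<Rightarrow> real"
  assumes weight_nonneg: "\<And>x y. x \<in> V \<Longrightarrow> y \<in> V \<Longrightarrow> 0 \<le> \<mu> x y"
    and weight_sym: "\<And>x y. x \<in> V \<Longrightarrow> y \<in> V \<Longrightarrow> \<mu> x y = \<mu> y x"
    and locally_finite: "\<And>x. x \<in> V \<Longrightarrow> finite (neighbours V \<mu> x)"
    and connected: "\<And>x y. x \<in> V \<Longrightarrow> y \<in> V \<Longrightarrow> (x, y) \<in> (edges V \<mu>)\<^sup>*"

text \<open>A pair lies in the \<open>n\<close>-th relational power of the edge relation iff it is joined by a walk
  of length \<open>n\<close>.\<close>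

definition graph_dist :: "'v set \<Rightarrow> ('v \<Rightarrow> 'v \<Rightarrow> real) \<Rightarrow> 'v \<Rightarrow> 'v \<Rightarrow> nat" where
  "graph_dist V \<mu> x y = (LEAST n. (x, y) \<in> edges V \<mu> ^^ n)"

definition graph_ball :: "'v set \<Rightarrow> ('v \<Rightarrow> 'v \<Rightarrow> real) \<Rightarrow> 'v \<Rightarrow> nat \<Rightarrow> 'v set" where
  "graph_ball V \<mu> x\<^sub>0 r = {x \<in> V. graph_dist V \<mu> x\<^sub>0 x \<le> r}"

text \<open>The sum runs over the (finitely many) neighbours rather than over \<open>V\<close>, because \<open>sum\<close> is
  \<open>0\<close> on infinite sets; all other terms vanish.\<close>

definition vertex_weight :: "'v set \<Rightarrow> ('v \<Rightarrow> 'v \<Rightarrow> real) \<Rightarrow> 'v \<Rightarrow> real" where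
  "vertex_weight V \<mu> x = (\<Sum>y\<in>neighbours V \<mu> x. \<mu> x y)"

text \<open>\<open>\<mu>\<^sub>-(x)\<close> and \<open>\<mu>\<^sub>0(x)\<close> with respect to the reference vertex \<open>x\<^sub>0\<close>. The condition on
  distances is stated additively to avoid truncated subtraction at \<open>x = x\<^sub>0\<close>.\<close>

definition weight_minus :: "'v set \<Rightarrow> ('v \<Rightarrow> 'v \<Rightarrow> real) \<Rightarrow> 'v \<Rightarrow> 'v \<Rightarrow> real" where
  "weight_minus V \<mu> x\<^sub>0 x =
     (\<Sum>y | y \<in> neighbours V \<mu> x \<and> graph_dist V \<mu> x\<^sub>0 y + 1 = graph_dist V \<mu> x\<^sub>0 x. \<mu> x y)"

definition weight_zero :: "'v set \<Rightarrow> ('v \<Rightarrow> 'v \<Rightarrow> real) \<Rightarrow> 'v \<Rightarrow> 'v \<Rightarrow> real" where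
  "weight_zero V \<mu> x\<^sub>0 x =
     (\<Sum>y | y \<in> neighbours V \<mu> x \<and> graph_dist V \<mu> x\<^sub>0 y = graph_dist V \<mu> x\<^sub>0 x. \<mu> x y)"

definition kappa :: "'v set \<Rightarrow> ('v \<Rightarrow> 'v \<Rightarrow> real) \<Rightarrow> 'v \<Rightarrow> nat \<Rightarrow> real" where
  "kappa V \<mu> x\<^sub>0 r =
     (SUP x\<in>graph_ball V \<mu> x\<^sub>0 r. weight_zero V \<mu> x\<^sub>0 x / vertex_weight V \<mu> x)"

text \<open>Real functions on \<open>\<Omega>\<close> are represented by functions on the whole vertex type whose values
  outside \<open>\<Omega>\<close> are irrelevant; in particular, such a function is nonzero iff it does not vanish
  identically on \<open>\<Omega>\<close>.\<close>

definition dirichlet_laplacian ::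
    "'v set \<Rightarrow> ('v \<Rightarrow> 'v \<Rightarrow> real) \<Rightarrow> 'v set \<Rightarrow> ('v \<Rightarrow> real) \<Rightarrow> 'v \<Rightarrow> real" where
  "dirichlet_laplacian V \<mu> \<Omega> f x = f x - (1 / vertex_weight V \<mu> x) * (\<Sum>y\<in>\<Omega>. \<mu> x y * f y)"

definition dirichlet_eigenvalue ::
    "'v set \<Rightarrow> ('v \<Rightarrow> 'v \<Rightarrow> real) \<Rightarrow> 'v set \<Rightarrow> real \<Rightarrow> bool" where
  "dirichlet_eigenvalue V \<mu> \<Omega> k \<longleftrightarrow>
     (\<exists>f. (\<exists>x\<in>\<Omega>. f x \<noteq> 0) \<and> (\<forall>x\<in>\<Omega>. dirichlet_laplacian V \<mu> \<Omega> f x = k * f x))"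

definition lambda_max :: "'v set \<Rightarrow> ('v \<Rightarrow> 'v \<Rightarrow> real) \<Rightarrow> 'v set \<Rightarrow> real" where
  "lambda_max V \<mu> \<Omega> = (GREATEST k. dirichlet_eigenvalue V \<mu> \<Omega> k)"

text \<open>The weights of the half-line \<open>R\<^sub>l\<close>, whose vertex set is \<open>UNIV :: nat set\<close>.\<close>

definition half_line :: "real \<Rightarrow> nat \<Rightarrow> nat \<Rightarrow> real" where
  "half_line l i j =
     (if j = Suc i then (l - 1) ^ i else if i = Suc j then (l - 1) ^ j else 0)"

definition half_line_ball :: "real \<Rightarrow> nat \<Rightarrow> nat set" where
  "half_line_ball l r = graph_ball UNIV (half_line l) 0 r"


lemma edges_half_line:
  assumes "2 \<le> l"
  shows "edges UNIV (half_line l) = {(i, j). j = Suc i \<or> i = Suc j}"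
  using assms by (auto simp: edges_def half_line_def split: if_splits)

lemma half_line_relpow_bound:
  assumes "2 \<le> l" and "(i, j) \<in> edges UNIV (half_line l) ^^ n"
  shows "j \<le> i + n"
  using assms(2)
proof (induction n arbitrary: j)
  case (Suc n)
  then obtain k where "(i, k) \<in> edges UNIV (half_line l) ^^ n" "(k, j) \<in> edges UNIV (half_line l)"
    by auto
  with Suc.IH[of k] show ?case by (auto simp: edges_half_line[OF assms(1)])
qed simp

lemma half_line_relpow_0:
  assumes "2 \<le> l"
  shows "(0, n) \<in> edges UNIV (half_line l) ^^ n"
proof (induction n)
  case (Suc n)
  then show ?case
    by (rule relpow_Suc_I) (simp add: edges_half_line[OF assms])
qed simp

lemma weighted_graph_half_line:
  assumes "2 \<le> l"
  shows "weighted_graph UNIV (half_line l)"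
proof
  fix x y :: nat
  let ?E = "edges UNIV (half_line l)"
  show "0 \<le> half_line l x y" "half_line l x y = half_line l y x"
    using assms by (auto simp: half_line_def)
  have "neighbours UNIV (half_line l) x \<subseteq> {..Suc x}"
    by (auto simp: neighbours_def edges_half_line[OF assms])
  then show "finite (neighbours UNIV (half_line l) x)"
    by (rule finite_subset) simp
  have "sym ?E" by (auto simp: edges_half_line[OF assms] sym_def)
  moreover have "(0, n) \<in> ?E\<^sup>*" for n
    using half_line_relpow_0[OF assms, of n] by (rule relpow_imp_rtrancl)
  ultimately show "(x, y) \<in> ?E\<^sup>*"
    by (meson sym_rtrancl symD rtrancl_trans)
qed

lemma graph_dist_half_line:
  assumes "2 \<le> l"
  shows "graph_dist UNIV (half_line l) 0 n = n"
  unfolding graph_dist_def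
  by (rule Least_equality)
    (use half_line_relpow_0[OF assms] half_line_relpow_bound[OF assms] in fastforce)+

lemma half_line_ball_eq:
  assumes "2 \<le> l"
  shows "half_line_ball l r = {..r}"
  by (auto simp: half_line_ball_def graph_ball_def graph_dist_half_line[OF assms])

text \<open>Balls are finite, so the suprema over balls in \<open>kappa\<close> and in the constant \<open>l\<close> are maxima.\<close>

lemma (in weighted_graph) finite_graph_ball:
  assumes "x\<^sub>0 \<in> V"
  shows "finite (graph_ball V \<mu> x\<^sub>0 r)"
proof -
  let ?E = "edges V \<mu>"
  have fin: "finite {x. (x\<^sub>0, x) \<in> ?E ^^ n}" for n
  proof (induction n)
    case (Suc n)
    have "{x. (x\<^sub>0, x) \<in> ?E ^^ Suc n} \<subseteq>
        (\<Union>y \<in> {x. (x\<^sub>0, x) \<in> ?E ^^ n} \<inter> V. neighbours V \<mu> y)"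
      by (auto simp: neighbours_def edges_def)
    moreover have "finite \<dots>"
      using Suc locally_finite by auto
    ultimately show ?case by (rule finite_subset)
  qed simp
  have "graph_ball V \<mu> x\<^sub>0 r \<subseteq> (\<Union>n\<le>r. {x. (x\<^sub>0, x) \<in> ?E ^^ n})"
  proof
    fix x assume x: "x \<in> graph_ball V \<mu> x\<^sub>0 r"
    then have "(x\<^sub>0, x) \<in> ?E\<^sup>*"
      using connected assms by (simp add: graph_ball_def)
    then have "\<exists>n. (x\<^sub>0, x) \<in> ?E ^^ n" by (simp add: rtrancl_power)
    then have "(x\<^sub>0, x) \<in> ?E ^^ graph_dist V \<mu> x\<^sub>0 x"
      unfolding graph_dist_def by (rule LeastI_ex)
    with x show "x \<in> (\<Union>n\<le>r. {x. (x\<^sub>0, x) \<in> ?E ^^ n})"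
      by (auto simp: graph_ball_def)
  qed
  then show ?thesis by (rule finite_subset) (use fin in auto)
qed

end

theory Submission
  imports Defs "HOL-Analysis.Function_Topology"
begin

text \<open>
  Write \<open>k\<close> for the largest Dirichlet eigenvalue of the ball \<open>{..r}\<close> of the half-line. The edges of
  the half-line join numbers of opposite parity, so replacing an eigenfunction \<open>g\<close> for \<open>k\<close> by
  \<open>(-1)^i \<bar>g i\<bar>\<close> can only increase its Rayleigh quotient. Hence \<open>k\<close> has an eigenfunction of the form
  \<open>(-1)^i f i\<close> with \<open>f \<ge> 0\<close>, and the eigenvalue equation, read as a balance of flows
  along the edges, forces \<open>f\<close> to be decreasing (\<open>half_line_top_eigenfunction\<close>).

  On the ball of \<open>\<Gamma>\<close> one takes the test function \<open>F x = (-1)^d(x) f(d(x))\<close>, where \<open>d(x)\<close> is the distance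
  from \<open>x\<^sub>0\<close>. With \<open>p = \<mu>\<^sub>-(x) / \<mu>(x)\<close>, \<open>q = \<mu>\<^sub>0(x) / \<mu>(x)\<close> and \<open>i = d(x) \<ge> 1\<close>, its Laplacian at \<open>x\<close> equals,
  up to the sign \<open>(-1)^i\<close>,
  \<open>f i + p f(i-1) + (1 - p) f(i+1) - q (f i + f(i+1))\<close>.
  As \<open>f\<close> is decreasing, the terms with \<open>p\<close> are smallest for the smallest \<open>p\<close>; since \<open>p \<ge> 1/l\<close>, the part
  without \<open>q\<close> is at least its half-line value \<open>k f i\<close>. Since \<open>q \<le> \<kappa>\<close> and \<open>f(i+1) \<le> f i\<close>, the part with \<open>q\<close>
  costs at most \<open>2 \<kappa> f i\<close>. At \<open>x\<^sub>0\<close> the same holds with \<open>p = 0\<close> and \<open>f 0 + f 1 = k f 0\<close>. So the Rayleigh quotient of \<open>F\<close> is at least \<open>k - 2 \<kappa>\<close>, and the largest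
  eigenvalue dominates every Rayleigh quotient (\<open>lambda_max_variational\<close>).
\<close>

section \<open>The variational characterisation of the largest Dirichlet eigenvalue\<close>

definition weighted_inner ::
    "'v set \<Rightarrow> ('v \<Rightarrow> 'v \<Rightarrow> real) \<Rightarrow> 'v set \<Rightarrow> ('v \<Rightarrow> real) \<Rightarrow> ('v \<Rightarrow> real) \<Rightarrow> real" where
  "weighted_inner V \<mu> \<Omega> f g = (\<Sum>x\<in>\<Omega>. vertex_weight V \<mu> x * f x * g x)"

abbreviation dirichlet_energy ::
    "'v set \<Rightarrow> ('v \<Rightarrow> 'v \<Rightarrow> real) \<Rightarrow> 'v set \<Rightarrow> ('v \<Rightarrow> real) \<Rightarrow> real" where
  "dirichlet_energy V \<mu> \<Omega> f \<equiv> weighted_inner V \<mu> \<Omega> (dirichlet_laplacian V \<mu> \<Omega> f) f"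

lemma dirichlet_laplacian_linear:
  "dirichlet_laplacian V \<mu> \<Omega> (\<lambda>x. f x + t * h x) x =
     dirichlet_laplacian V \<mu> \<Omega> f x + t * dirichlet_laplacian V \<mu> \<Omega> h x"
  by (simp add: dirichlet_laplacian_def algebra_simps sum.distrib sum_distrib_left sum_distrib_right)

text \<open>A linear term in \<open>t\<close> dominates a quadratic one near \<open>0\<close>. This gives the first-order
  condition at a maximum of a quadratic form without differentiation.\<close>

lemma linear_term_vanishes:
  fixes c d :: real
  assumes "\<And>t. 2 * t * c \<le> t\<^sup>2 * d"
  shows "c = 0"
proof -
  define t where "t = c / (\<bar>d\<bar> + 1)"
  have c: "c = t * (\<bar>d\<bar> + 1)"
    by (simp add: t_def)
  have "t\<^sup>2 * (2 * (\<bar>d\<bar> + 1) - d) \<le> 0"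
    using assms[of t] by (simp add: c power2_eq_square algebra_simps)
  then have "t = 0"
    by (simp add: mult_le_0_iff) linarith
  with c show ?thesis by simp
qed

lemma (in weighted_graph) vertex_weight_pos:
  assumes "infinite V" "x \<in> V"
  shows "0 < vertex_weight V \<mu> x"
proof -
  obtain y where "y \<in> V" "y \<noteq> x"
    using assms by (metis finite.simps finite_subset insertI1 subsetI)
  then obtain z where "(x, z) \<in> edges V \<mu>"
    using connected[OF assms(2)] by (metis converse_rtranclE)
  then have "neighbours V \<mu> x \<noteq> {}"
    by (auto simp: neighbours_def)
  then show ?thesis
    unfolding vertex_weight_def using locally_finite[OF assms(2)]
    by (intro sum_pos) (auto simp: neighbours_def edges_def)
qed

lemma weighted_inner_pos:
  assumes "finite \<Omega>" "\<And>x. x \<in> \<Omega> \<Longrightarrow> 0 < vertex_weight V \<mu> x" "\<exists>x\<in>\<Omega>. f x \<noteq> 0"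
  shows "0 < weighted_inner V \<mu> \<Omega> f f"
proof -
  obtain x where "x \<in> \<Omega>" "f x \<noteq> 0"
    using assms(3) by blast
  then have "0 < vertex_weight V \<mu> x * (f x * f x)"
    using assms(2) by (simp add: zero_less_mult_iff linorder_neq_iff disj_commute)
  moreover have "0 \<le> vertex_weight V \<mu> y * (f y * f y)" if "y \<in> \<Omega>" for y
    using assms(2)[OF that] by simp
  ultimately show ?thesis
    unfolding weighted_inner_def mult.assoc
    using sum_pos2[OF assms(1) \<open>x \<in> \<Omega>\<close>, of "\<lambda>y. vertex_weight V \<mu> y * (f y * f y)"] by blast
qed

lemma dirichlet_energy_eq:
  assumes "\<And>x. x \<in> \<Omega> \<Longrightarrow> vertex_weight V \<mu> x \<noteq> 0"
  shows "weighted_inner V \<mu> \<Omega> (dirichlet_laplacian V \<mu> \<Omega> f) g =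
    weighted_inner V \<mu> \<Omega> f g - (\<Sum>x\<in>\<Omega>. \<Sum>y\<in>\<Omega>. \<mu> x y * f y * g x)"
  unfolding weighted_inner_def sum_subtractf[symmetric]
  by (rule sum.cong)
    (auto simp: dirichlet_laplacian_def assms algebra_simps sum_distrib_left sum_distrib_right)

lemma weighted_inner_commute: "weighted_inner V \<mu> \<Omega> f g = weighted_inner V \<mu> \<Omega> g f"
  by (simp add: weighted_inner_def mult_ac)

lemma (in weighted_graph) dirichlet_laplacian_self_adjoint:
  assumes "\<Omega> \<subseteq> V" "\<And>x. x \<in> \<Omega> \<Longrightarrow> vertex_weight V \<mu> x \<noteq> 0"
  shows "weighted_inner V \<mu> \<Omega> (dirichlet_laplacian V \<mu> \<Omega> f) g =
    weighted_inner V \<mu> \<Omega> (dirichlet_laplacian V \<mu> \<Omega> g) f"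
proof -
  have "(\<Sum>x\<in>\<Omega>. \<Sum>y\<in>\<Omega>. \<mu> x y * f y * g x) = (\<Sum>x\<in>\<Omega>. \<Sum>y\<in>\<Omega>. \<mu> x y * g y * f x)"
    by (subst sum.swap, intro sum.cong refl) (use assms(1) weight_sym in \<open>auto simp: mult_ac\<close>)
  then show ?thesis
    by (simp add: dirichlet_energy_eq[OF assms(2)] weighted_inner_commute[of _ _ _ f g])
qed

text \<open>The form \<open>h \<mapsto> \<langle>\<Delta>h, h\<rangle> - k \<langle>h, h\<rangle>\<close> is nonpositive and vanishes at \<open>f\<close>, so its first variation
  at \<open>f\<close> is zero; testing with the indicator of \<open>x\<close> yields the eigenvalue equation at \<open>x\<close>.\<close>

lemma (in weighted_graph) maximizer_is_eigenfunction:
  assumes "finite \<Omega>" "\<Omega> \<subseteq> V" and pos: "\<And>x. x \<in> \<Omega> \<Longrightarrow> 0 < vertex_weight V \<mu> x"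
    and le: "\<And>h. dirichlet_energy V \<mu> \<Omega> h \<le> k * weighted_inner V \<mu> \<Omega> h h"
    and eq: "k * weighted_inner V \<mu> \<Omega> f f \<le> dirichlet_energy V \<mu> \<Omega> f"
    and x: "x \<in> \<Omega>"
  shows "dirichlet_laplacian V \<mu> \<Omega> f x = k * f x"
proof -
  let ?L = "dirichlet_laplacian V \<mu> \<Omega>" and ?I = "weighted_inner V \<mu> \<Omega>"
  have add: "?I (\<lambda>x. a x + t * b x) c = ?I a c + t * ?I b c"
    and add': "?I c (\<lambda>x. a x + t * b x) = ?I c a + t * ?I c b" for a b c t
    by (simp_all add: weighted_inner_def algebra_simps sum.distrib sum_distrib_left)
  have adj: "?I (?L a) b = ?I (?L b) a" for a b
    by (rule dirichlet_laplacian_self_adjoint[OF assms(2)]) (use pos in force)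
  define h :: "'v \<Rightarrow> real" where "h = (\<lambda>y. if y = x then 1 else 0)"
  have h: "?I a h = vertex_weight V \<mu> x * a x" for a
  proof -
    have "?I a h = (\<Sum>y\<in>\<Omega>. if y = x then vertex_weight V \<mu> x * a x else 0)"
      unfolding weighted_inner_def h_def by (rule sum.cong) auto
    then show ?thesis
      using x assms(1) by simp
  qed
  have "?I (?L f) h - k * ?I f h = 0"
  proof (rule linear_term_vanishes)
    fix t
    have "?L (\<lambda>x. f x + t * h x) = (\<lambda>x. ?L f x + t * ?L h x)"
      by (rule ext) (rule dirichlet_laplacian_linear)
    then show "2 * t * (?I (?L f) h - k * ?I f h) \<le> t\<^sup>2 * (k * ?I h h - ?I (?L h) h)"
      using le[of "\<lambda>x. f x + t * h x"] eq
      by (simp add: add add' adj[of h f] weighted_inner_commute[of _ _ _ h f] power2_eq_square algebra_simps)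
  qed
  then show ?thesis
    using pos[OF x] by (simp add: h algebra_simps)
qed

text \<open>The Rayleigh quotient is maximised over the unit sphere, which is compact because \<open>\<Omega>\<close> is
  finite. To use the product topology on the full function space, functions are made to vanish
  outside \<open>\<Omega>\<close>, and the sphere is realised as a closed subset of a product of intervals.\<close>

lemma (in weighted_graph) rayleigh_maximum_exists:
  assumes fin: "finite \<Omega>" and "\<Omega> \<subseteq> V" "\<Omega> \<noteq> {}"
    and pos: "\<And>x. x \<in> \<Omega> \<Longrightarrow> 0 < vertex_weight V \<mu> x"
  obtains k f where "\<exists>x\<in>\<Omega>. f x \<noteq> 0" "dirichlet_energy V \<mu> \<Omega> f = k * weighted_inner V \<mu> \<Omega> f f"
    "\<forall>h. dirichlet_energy V \<mu> \<Omega> h \<le> k * weighted_inner V \<mu> \<Omega> h h"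
proof -
  let ?L = "dirichlet_laplacian V \<mu> \<Omega>" and ?I = "weighted_inner V \<mu> \<Omega>"
  let ?m = "vertex_weight V \<mu>"
  \<comment> \<open>A function of norm one has \<open>\<mu>(x) (f x)\<^sup>2 \<le> 1\<close> at each \<open>x\<close>, hence the radii of the intervals.\<close>
  define K where "K = (\<Pi>\<^sub>E x\<in>UNIV. if x \<in> \<Omega> then {- 1 / sqrt (?m x)..1 / sqrt (?m x)} else {0})"
  define S where "S = K \<inter> {f. ?I f f = 1}"
  have coord: "continuous_on UNIV (\<lambda>f::'v \<Rightarrow> real. f x)" for x
    by (rule continuous_on_product_coordinates)
  have contI: "continuous_on UNIV (\<lambda>f. ?I f f)"
    unfolding weighted_inner_def by (intro continuous_intros coord)
  have contE: "continuous_on UNIV (\<lambda>f. ?I (?L f) f)"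
    unfolding weighted_inner_def dirichlet_laplacian_def by (intro continuous_intros coord)
  have "compactin (product_topology (\<lambda>_. euclidean) UNIV) K"
    unfolding K_def compactin_PiE by auto
  then have "compact K"
    by (simp add: euclidean_product_topology)
  moreover have "closed {f. ?I f f = 1}"
    using contI by (intro closed_Collect_eq) auto
  ultimately have "compact S"
    unfolding S_def by (rule compact_Int_closed)
  have normalize: "\<exists>h\<in>S. \<forall>x\<in>\<Omega>. f x = c * h x" if "0 < ?I f f" "c = sqrt (?I f f)" for f c
  proof -
    define h where "h = (\<lambda>x. if x \<in> \<Omega> then f x / c else 0)"
    have c: "0 < c" "c\<^sup>2 = ?I f f"
      using that by auto
    have "?I h h = (\<Sum>x\<in>\<Omega>. ?m x * f x * f x / c\<^sup>2)"
      unfolding weighted_inner_def h_def by (rule sum.cong) (auto simp: power2_eq_square)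
    also have "\<dots> = ?I f f / c\<^sup>2"
      by (simp add: weighted_inner_def sum_divide_distrib)
    finally have I: "?I h h = 1"
      using c that by simp
    have "\<bar>h x\<bar> \<le> 1 / sqrt (?m x)" if x: "x \<in> \<Omega>" for x
    proof -
      have "?m x * h x * h x \<le> ?I h h"
        unfolding weighted_inner_def
        by (rule member_le_sum[OF x]) (use pos fin in \<open>auto simp: mult.assoc less_imp_le\<close>)
      then have "(sqrt (?m x) * \<bar>h x\<bar>)\<^sup>2 \<le> 1\<^sup>2"
        using I pos[OF x] by (simp add: power_mult_distrib power2_eq_square mult_ac)
      then have "sqrt (?m x) * \<bar>h x\<bar> \<le> 1"
        by (rule power2_le_imp_le) simp
      then show ?thesis
        using pos[OF x] by (simp add: field_simps)
    qed
    then have "h x \<in> (if x \<in> \<Omega> then {- 1 / sqrt (?m x)..1 / sqrt (?m x)} else {0})" for x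
      by (cases "x \<in> \<Omega>") (force simp: abs_le_iff, simp add: h_def)
    then have "h \<in> K"
      unfolding K_def by (simp only: PiE_UNIV_domain Pi_iff) blast
    moreover have "\<forall>x\<in>\<Omega>. f x = c * h x"
      using c by (simp add: h_def)
    ultimately show ?thesis
      using I by (auto simp: S_def)
  qed
  have "0 < ?I (\<lambda>x. 1) (\<lambda>x. 1)"
    by (rule weighted_inner_pos) (use assms in auto)
  with normalize have "S \<noteq> {}" by fast
  from continuous_attains_sup[OF \<open>compact S\<close> this continuous_on_subset[OF contE subset_UNIV]]
  obtain f where f: "f \<in> S" "\<And>g. g \<in> S \<Longrightarrow> ?I (?L g) g \<le> ?I (?L f) f"
    by (elim bexE) simp
  have f1: "?I f f = 1"
    using f by (simp add: S_def)
  show ?thesis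
  proof (rule that[of f "?I (?L f) f"])
    show "\<exists>x\<in>\<Omega>. f x \<noteq> 0"
    proof (rule ccontr)
      assume "\<not> (\<exists>x\<in>\<Omega>. f x \<noteq> 0)"
      then have "?I f f = 0"
        by (simp add: weighted_inner_def)
      with f1 show False by simp
    qed
    show "?I (?L f) f = ?I (?L f) f * ?I f f"
      by (simp add: f1)
    show "\<forall>g. ?I (?L g) g \<le> ?I (?L f) f * ?I g g"
    proof
      fix g
      show "?I (?L g) g \<le> ?I (?L f) f * ?I g g"
      proof (cases "\<exists>x\<in>\<Omega>. g x \<noteq> 0")
        case True
        define c where "c = sqrt (?I g g)"
        have g: "0 < ?I g g"
          using weighted_inner_pos[OF fin pos True] .
        then have c: "c\<^sup>2 = ?I g g"
          by (simp add: c_def)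
        obtain h where h: "h \<in> S" "\<And>x. x \<in> \<Omega> \<Longrightarrow> g x = c * h x"
          using normalize[OF g c_def] by blast
        have "?L g x = c * ?L h x" if "x \<in> \<Omega>" for x
          using that h(2) by (simp add: dirichlet_laplacian_def algebra_simps sum_distrib_left)
        then have "?I (?L g) g = c\<^sup>2 * ?I (?L h) h"
          using h(2) by (simp add: weighted_inner_def sum_distrib_left power2_eq_square mult_ac)
        then show ?thesis
          using f(2)[OF h(1)] c g by (simp add: mult.commute mult_left_mono)
      next
        case False
        then show ?thesis
          by (simp add: weighted_inner_def)
      qed
    qed
  qed
qed

text \<open>A maximiser of the Rayleigh quotient is an eigenfunction for the maximum, and each eigenvalue
  is the Rayleigh quotient of its eigenfunction. So a greatest eigenvalue exists, and it is that
  maximum.\<close>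

lemma (in weighted_graph) lambda_max_variational:
  assumes fin: "finite \<Omega>" and sub: "\<Omega> \<subseteq> V" and "\<Omega> \<noteq> {}"
    and pos: "\<And>x. x \<in> \<Omega> \<Longrightarrow> 0 < vertex_weight V \<mu> x"
  shows dirichlet_energy_le_lambda_max:
      "\<And>h. dirichlet_energy V \<mu> \<Omega> h \<le> lambda_max V \<mu> \<Omega> * weighted_inner V \<mu> \<Omega> h h"
    and dirichlet_eigenvalue_lambda_max: "dirichlet_eigenvalue V \<mu> \<Omega> (lambda_max V \<mu> \<Omega>)"
proof -
  obtain f k where f: "\<exists>x\<in>\<Omega>. f x \<noteq> 0"
      "dirichlet_energy V \<mu> \<Omega> f = k * weighted_inner V \<mu> \<Omega> f f"
    and max: "\<forall>h. dirichlet_energy V \<mu> \<Omega> h \<le> k * weighted_inner V \<mu> \<Omega> h h"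
    by (rule rayleigh_maximum_exists[OF assms])
  note k = max[rule_format]
  have "dirichlet_laplacian V \<mu> \<Omega> f x = k * f x" if "x \<in> \<Omega>" for x
    by (rule maximizer_is_eigenfunction[OF fin sub pos k _ that]) (simp_all add: f(2))
  with f(1) have ev: "dirichlet_eigenvalue V \<mu> \<Omega> k"
    unfolding dirichlet_eigenvalue_def by blast
  have "lambda_max V \<mu> \<Omega> = k"
    unfolding lambda_max_def
  proof (rule Greatest_equality)
    show "dirichlet_eigenvalue V \<mu> \<Omega> k"
      by (rule ev)
    fix k' assume "dirichlet_eigenvalue V \<mu> \<Omega> k'"
    then obtain g where g: "\<exists>x\<in>\<Omega>. g x \<noteq> 0"
        "\<And>x. x \<in> \<Omega> \<Longrightarrow> dirichlet_laplacian V \<mu> \<Omega> g x = k' * g x"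
      unfolding dirichlet_eigenvalue_def by blast
    have "k' * weighted_inner V \<mu> \<Omega> g g = dirichlet_energy V \<mu> \<Omega> g"
      by (simp add: weighted_inner_def g(2) sum_distrib_left mult_ac)
    also have "\<dots> \<le> k * weighted_inner V \<mu> \<Omega> g g"
      by (rule k)
    finally show "k' \<le> k"
      using weighted_inner_pos[OF fin pos g(1)] by simp
  qed
  with k ev show "\<And>h. dirichlet_energy V \<mu> \<Omega> h \<le> lambda_max V \<mu> \<Omega> * weighted_inner V \<mu> \<Omega> h h"
    and "dirichlet_eigenvalue V \<mu> \<Omega> (lambda_max V \<mu> \<Omega>)"
    by auto
qed

lemma (in weighted_graph) lambda_max_ge_of_pointwise:
  assumes fin: "finite \<Omega>" and sub: "\<Omega> \<subseteq> V" and nz: "\<exists>x\<in>\<Omega>. F x \<noteq> 0"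
    and pos: "\<And>x. x \<in> \<Omega> \<Longrightarrow> 0 < vertex_weight V \<mu> x"
    and ge: "\<And>x. x \<in> \<Omega> \<Longrightarrow> c * (F x)\<^sup>2 \<le> dirichlet_laplacian V \<mu> \<Omega> F x * F x"
  shows "c \<le> lambda_max V \<mu> \<Omega>"
proof -
  have "c * weighted_inner V \<mu> \<Omega> F F = (\<Sum>x\<in>\<Omega>. vertex_weight V \<mu> x * (c * (F x)\<^sup>2))"
    by (simp add: weighted_inner_def sum_distrib_left power2_eq_square mult_ac)
  also have "\<dots> \<le> (\<Sum>x\<in>\<Omega>. vertex_weight V \<mu> x * (dirichlet_laplacian V \<mu> \<Omega> F x * F x))"
    by (intro sum_mono mult_left_mono ge less_imp_le[OF pos])
  also have "\<dots> = dirichlet_energy V \<mu> \<Omega> F"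
    by (simp add: weighted_inner_def mult_ac)
  also have "\<dots> \<le> lambda_max V \<mu> \<Omega> * weighted_inner V \<mu> \<Omega> F F"
    by (rule dirichlet_energy_le_lambda_max[OF fin sub _ pos]) (use nz in auto)
  finally show ?thesis
    using weighted_inner_pos[OF fin pos nz] by simp
qed

section \<open>The top eigenfunction of a ball in the half-line\<close>

lemma neighbours_half_line:
  assumes "2 \<le> l"
  shows "neighbours UNIV (half_line l) 0 = {1}"
    and "neighbours UNIV (half_line l) (Suc i) = {i, Suc (Suc i)}"
  by (auto simp: neighbours_def edges_half_line[OF assms])

lemma vertex_weight_half_line:
  assumes "2 \<le> l"
  shows "vertex_weight UNIV (half_line l) 0 = 1"
    and "vertex_weight UNIV (half_line l) (Suc i) = l * (l - 1) ^ i"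
  by (simp_all add: vertex_weight_def neighbours_half_line[OF assms] half_line_def algebra_simps)

lemma dirichlet_laplacian_half_line:
  assumes "2 \<le> l" "\<And>i. r < i \<Longrightarrow> g i = 0"
  shows "dirichlet_laplacian UNIV (half_line l) {..r} g 0 = g 0 - g 1"
    and "i < r \<Longrightarrow> dirichlet_laplacian UNIV (half_line l) {..r} g (Suc i) =
      g (Suc i) - g i / l - (1 - 1 / l) * g (Suc (Suc i))"
proof -
  have "(\<Sum>j\<le>r. half_line l 0 j * g j) = (\<Sum>j\<in>{1}. half_line l 0 j * g j)"
    using assms(2) by (intro sum.mono_neutral_cong) (auto simp: half_line_def not_le)
  then show "dirichlet_laplacian UNIV (half_line l) {..r} g 0 = g 0 - g 1"
    by (simp add: dirichlet_laplacian_def vertex_weight_half_line[OF assms(1)] half_line_def)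
  assume "i < r"
  then have "(\<Sum>j\<le>r. half_line l (Suc i) j * g j) = (\<Sum>j\<in>{i, Suc (Suc i)}. half_line l (Suc i) j * g j)"
    using assms(2) by (intro sum.mono_neutral_cong) (auto simp: half_line_def not_le)
  then show "dirichlet_laplacian UNIV (half_line l) {..r} g (Suc i) =
      g (Suc i) - g i / l - (1 - 1 / l) * g (Suc (Suc i))"
    using assms(1)
    by (simp add: dirichlet_laplacian_def vertex_weight_half_line[OF assms(1)] half_line_def)
      (simp add: field_simps)
qed

text \<open>
  Multiplied by \<open>l\<close>, the recursion says that the decrement \<open>f(i+1) - f(i+2)\<close>, weighted by \<open>l - 1\<close>,
  exceeds \<open>f i - f(i+1)\<close> by the source term \<open>l (2 - k) f(i+1)\<close>. If \<open>k \<le> 2\<close>, the sources are nonnegative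
  and all decrements inherit the sign of the first one. If \<open>k > 2\<close>, the same argument makes \<open>f\<close>
  increasing up to \<open>r + 1\<close>, where it vanishes; then \<open>f\<close> would be zero.
\<close>

lemma half_line_flow_bound:
  assumes l: "2 \<le> l" and nonneg: "\<And>i. 0 \<le> f i" and zero: "\<And>i. r < i \<Longrightarrow> f i = 0" and nz: "\<exists>i. f i \<noteq> 0"
    and base: "f 0 + f 1 = k * f 0"
    and step: "\<And>i. i < r \<Longrightarrow> f (Suc i) + f i / l + (1 - 1 / l) * f (Suc (Suc i)) = k * f (Suc i)"
  shows "(f (Suc i) :: real) \<le> f i"
proof -
  have flow: "(l - 1) * (f (Suc i) - f (Suc (Suc i))) = (f i - f (Suc i)) + l * ((2 - k) * f (Suc i))"
    if "i < r" for i
    using arg_cong[OF step[OF that], of "\<lambda>x. l * x"] l by (simp add: algebra_simps)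
  have k: "k \<le> 2"
  proof (rule ccontr)
    assume "\<not> k \<le> 2"
    have incr: "f i \<le> f (Suc i)" if "i \<le> r" for i
      using that
    proof (induction i)
      case 0
      have "f 1 - f 0 = (k - 2) * f 0"
        using base by (simp add: algebra_simps)
      also have "\<dots> \<ge> 0"
        using \<open>\<not> k \<le> 2\<close> nonneg by simp
      finally show ?case by simp
    next
      case (Suc i)
      have "(2 - k) * f (Suc i) \<le> 0"
        using \<open>\<not> k \<le> 2\<close> nonneg[of "Suc i"] by (simp add: mult_le_0_iff)
      then have "l * ((2 - k) * f (Suc i)) \<le> 0"
        using l by (simp add: mult_le_0_iff)
      then have "(l - 1) * (f (Suc i) - f (Suc (Suc i))) \<le> 0"
        using flow[of i] Suc by simp
      then show ?case
        using l by (simp add: mult_le_0_iff)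
    qed
    have "f i \<le> f (Suc r)" if "i \<le> Suc r" for i
      using that by (induction rule: inc_induct) (auto intro: order_trans[OF incr])
    then have "f i = 0" for i
      using zero[of i] zero[of "Suc r"] nonneg[of i] by (metis le_SucI lessI linorder_not_less order_antisym)
    with nz show False by blast
  qed
  show ?thesis
  proof (induction i)
    case 0
    have "f 0 - f 1 = (2 - k) * f 0"
      using base by (simp add: algebra_simps)
    also have "\<dots> \<ge> 0"
      using k nonneg by simp
    finally show ?case by simp
  next
    case (Suc i)
    show ?case
    proof (cases "i < r")
      case True
      have "0 \<le> l * ((2 - k) * f (Suc i))"
        using k l nonneg by simp
      then have "0 \<le> (l - 1) * (f (Suc i) - f (Suc (Suc i)))"
        using flow[OF True] Suc by simp
      then show ?thesis
        using l by (simp add: zero_le_mult_iff)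
    next
      case False
      then show ?thesis
        using zero[of "Suc (Suc i)"] nonneg by simp
    qed
  qed
qed

text \<open>Taking absolute values and alternating signs makes every product over an edge as negative as
  possible and keeps the norm, so it turns a maximiser of the Rayleigh quotient into a maximiser,
  which again solves the eigenvalue equation. The conclusion is stated for the unsigned
  profile \<open>f\<close>; its vanishing beyond \<open>r\<close> encodes the Dirichlet condition.\<close>

lemma half_line_top_eigenfunction:
  fixes l :: real and r :: nat
  assumes l: "2 \<le> l"
  defines "k \<equiv> lambda_max UNIV (half_line l) (half_line_ball l r)"
  obtains f :: "nat \<Rightarrow> real" where "0 < f 0" "\<forall>i. 0 \<le> f i" "\<forall>i. f (Suc i) \<le> f i"
    "\<forall>i>r. f i = 0" "f 0 + f 1 = k * f 0"
    "\<forall>i<r. f (Suc i) + f i / l + (1 - 1 / l) * f (Suc (Suc i)) = k * f (Suc i)"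
proof -
  interpret R: weighted_graph UNIV "half_line l"
    by (rule weighted_graph_half_line[OF l])
  let ?L = "dirichlet_laplacian UNIV (half_line l) {..r}"
  let ?I = "weighted_inner UNIV (half_line l) {..r}"
  have pos: "0 < vertex_weight UNIV (half_line l) x" for x
    by (rule R.vertex_weight_pos) auto
  have pos': "vertex_weight UNIV (half_line l) x \<noteq> 0" for x
    using pos[of x] by simp
  have k: "k = lambda_max UNIV (half_line l) {..r}"
    by (simp add: k_def half_line_ball_eq[OF l])
  have max: "?I (?L h) h \<le> k * ?I h h" for h
    unfolding k by (rule R.dirichlet_energy_le_lambda_max) (auto simp: pos)
  obtain g where g: "\<exists>i\<le>r. g i \<noteq> 0" "\<And>i. i \<le> r \<Longrightarrow> ?L g i = k * g i"
    using R.dirichlet_eigenvalue_lambda_max[of "{..r}"] pos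
    by (auto simp: dirichlet_eigenvalue_def k)
  define f where "f i = (if i \<le> r then \<bar>g i\<bar> else 0)" for i
  define G where "G i = (- 1) ^ i * f i" for i
  have f0: "f i = 0" if "r < i" for i
    using that by (simp add: f_def)
  have G0: "G i = 0" if "r < i" for i
    using that by (simp add: G_def f0)
  have II: "?I G G = ?I g g"
    unfolding weighted_inner_def
    by (rule sum.cong) (auto simp: G_def f_def mult_ac simp flip: power_add mult_2)
  have cross: "half_line l i j * G j * G i \<le> half_line l i j * g j * g i" if "i \<le> r" "j \<le> r" for i j
  proof (cases "j = Suc i \<or> i = Suc j")
    case True
    then have "G j * G i = - \<bar>g j * g i\<bar>"
      using that by (auto simp: G_def f_def abs_mult mult_ac simp flip: power_add mult_2)
    then have "G j * G i \<le> g j * g i"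
      by simp
    moreover have "0 \<le> half_line l i j"
      using l by (simp add: half_line_def)
    ultimately show ?thesis
      by (simp add: mult.assoc mult_left_mono)
  next
    case False
    then show ?thesis by (simp add: half_line_def)
  qed
  have "k * ?I G G = ?I (?L g) g"
    by (simp add: II) (simp add: weighted_inner_def g(2) sum_distrib_left mult_ac)
  also have "\<dots> \<le> ?I (?L G) G"
    unfolding dirichlet_energy_eq[OF pos'] II
    by (intro diff_left_mono sum_mono cross) auto
  finally have LG: "?L G i = k * G i" if "i \<le> r" for i
    by (intro R.maximizer_is_eigenfunction) (use that pos max in auto)
  have base: "f 0 + f 1 = k * f 0"
    using LG[of 0] by (simp add: dirichlet_laplacian_half_line[OF l G0] G_def)
  have step: "f (Suc i) + f i / l + (1 - 1 / l) * f (Suc (Suc i)) = k * f (Suc i)" if "i < r" for i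
  proof -
    have "(- 1) ^ Suc i * (f (Suc i) + f i / l + (1 - 1 / l) * f (Suc (Suc i)))
        = (- 1) ^ Suc i * (k * f (Suc i))"
      using LG[of "Suc i"] that
      by (simp add: dirichlet_laplacian_half_line[OF l G0] G_def algebra_simps)
    then show ?thesis
      by (subst (asm) mult_cancel_left) simp
  qed
  have nonneg: "0 \<le> f i" for i
    by (simp add: f_def)
  have nz: "\<exists>i. f i \<noteq> 0"
    using g(1) by (auto simp: f_def)
  have decr: "f (Suc i) \<le> f i" for i
    using half_line_flow_bound[OF l nonneg f0 nz base step] .
  have "f i \<le> f 0" for i
    by (induction i) (use decr order_trans in auto)
  with nz have "0 < f 0"
    using nonneg by (metis order_antisym not_le)
  then show ?thesis
    using that nonneg decr f0 base step by blast
qed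

section \<open>Distances from the reference vertex\<close>

lemma (in weighted_graph) graph_dist_walk:
  assumes "x \<in> V" "y \<in> V"
  shows "(x, y) \<in> edges V \<mu> ^^ graph_dist V \<mu> x y"
  using connected[OF assms] unfolding graph_dist_def rtrancl_power by (rule LeastI_ex)

lemma (in weighted_graph) graph_dist_self: "graph_dist V \<mu> x x = 0"
  by (simp add: graph_dist_def)

lemma (in weighted_graph) graph_dist_edge_le:
  assumes "x\<^sub>0 \<in> V" "(x, y) \<in> edges V \<mu>"
  shows "graph_dist V \<mu> x\<^sub>0 y \<le> Suc (graph_dist V \<mu> x\<^sub>0 x)"
proof -
  have "x \<in> V"
    using assms by (simp add: edges_def)
  then have "(x\<^sub>0, y) \<in> edges V \<mu> ^^ Suc (graph_dist V \<mu> x\<^sub>0 x)"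
    using graph_dist_walk[OF assms(1)] assms(2) by auto
  then show ?thesis
    unfolding graph_dist_def[of _ _ _ y] by (rule Least_le)
qed

lemma (in weighted_graph) edges_sym: "(x, y) \<in> edges V \<mu> \<Longrightarrow> (y, x) \<in> edges V \<mu>"
  by (auto simp: edges_def weight_sym)

lemma (in weighted_graph) graph_dist_neighbour_cases:
  assumes "x\<^sub>0 \<in> V" "y \<in> neighbours V \<mu> x"
  obtains "graph_dist V \<mu> x\<^sub>0 y + 1 = graph_dist V \<mu> x\<^sub>0 x"
    | "graph_dist V \<mu> x\<^sub>0 y = graph_dist V \<mu> x\<^sub>0 x"
    | "graph_dist V \<mu> x\<^sub>0 y = Suc (graph_dist V \<mu> x\<^sub>0 x)"
proof -
  have "(x, y) \<in> edges V \<mu>"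
    using assms by (simp add: neighbours_def)
  then show ?thesis
    using graph_dist_edge_le[OF assms(1)] edges_sym that by (metis Suc_eq_plus1 le_SucE le_antisym)
qed

text \<open>The predecessor of \<open>x\<close> on a shortest walk from \<open>x\<^sub>0\<close> contributes. Positivity matters because
  otherwise \<open>\<mu>(x) / \<mu>\<^sub>-(x)\<close> would be \<open>0\<close> by the convention for division by zero, and an upper bound for
  it would say nothing about \<open>\<mu>\<^sub>-(x)\<close>.\<close>

lemma (in weighted_graph) weight_minus_pos:
  assumes "x\<^sub>0 \<in> V" "x \<in> V" "x \<noteq> x\<^sub>0"
  shows "0 < weight_minus V \<mu> x\<^sub>0 x"
proof -
  let ?d = "graph_dist V \<mu> x\<^sub>0"
  have walk: "(x\<^sub>0, x) \<in> edges V \<mu> ^^ ?d x"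
    by (rule graph_dist_walk[OF assms(1,2)])
  with assms obtain n where n: "?d x = Suc n"
    by (cases "?d x") auto
  with walk obtain y where y: "(x\<^sub>0, y) \<in> edges V \<mu> ^^ n" "(y, x) \<in> edges V \<mu>"
    by auto
  have "?d y \<le> n"
    unfolding graph_dist_def using y(1) by (rule Least_le)
  with graph_dist_edge_le[OF assms(1) y(2)] n have "?d y + 1 = ?d x"
    by simp
  then have "y \<in> {y \<in> neighbours V \<mu> x. ?d y + 1 = ?d x}"
    using edges_sym[OF y(2)] by (simp add: neighbours_def)
  then show ?thesis
    unfolding weight_minus_def
    by (intro sum_pos) (auto simp: neighbours_def edges_def intro: finite_subset[OF _ locally_finite[OF assms(2)]])
qed

section \<open>Comparison of radial functions\<close>

text \<open>Each neighbour of \<open>x\<close> is first treated as if it were one step further out, with value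
  \<open>-f(i+1)\<close> relative to the sign at \<open>x\<close>; the other two terms correct this for the neighbours one
  step closer and for those at the same distance. So the right-hand side involves only the weights
  that the hypotheses of the comparison control. For \<open>i = 0\<close> the truncated \<open>i - 1\<close> is harmless, since the weight \<open>\<mu>\<^sub>-\<close> vanishes at \<open>x\<^sub>0\<close>.\<close>

lemma (in weighted_graph) sum_alternating_radial:
  fixes f :: "nat \<Rightarrow> real"
  assumes x0: "x\<^sub>0 \<in> V" and x: "x \<in> V" and i: "graph_dist V \<mu> x\<^sub>0 x = i"
    and zero: "\<And>i. r < i \<Longrightarrow> f i = 0"
  defines "d \<equiv> graph_dist V \<mu> x\<^sub>0"
  shows "(-1) ^ i * (\<Sum>y\<in>graph_ball V \<mu> x\<^sub>0 r. \<mu> x y * ((-1) ^ d y * f (d y))) =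
    - f (Suc i) * vertex_weight V \<mu> x - (f (i - 1) - f (Suc i)) * weight_minus V \<mu> x\<^sub>0 x
    + (f i + f (Suc i)) * weight_zero V \<mu> x\<^sub>0 x"
proof -
  let ?N = "neighbours V \<mu> x"
  have fin: "finite ?N"
    by (rule locally_finite[OF x])
  have dx: "d x = i"
    by (simp add: d_def i)
  have "(\<Sum>y\<in>graph_ball V \<mu> x\<^sub>0 r. \<mu> x y * ((-1) ^ d y * f (d y)))
      = (\<Sum>y\<in>?N. \<mu> x y * ((-1) ^ d y * f (d y)))"
  proof (rule sum.mono_neutral_cong)
    show "finite (graph_ball V \<mu> x\<^sub>0 r)"
      by (rule finite_graph_ball[OF x0])
    fix y assume "y \<in> graph_ball V \<mu> x\<^sub>0 r - ?N"
    then have "y \<in> V" "\<not> 0 < \<mu> x y"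
      using x by (auto simp: graph_ball_def neighbours_def edges_def)
    then show "\<mu> x y * ((-1) ^ d y * f (d y)) = 0"
      using weight_nonneg[OF x, of y] by simp
  next
    fix y assume "y \<in> ?N - graph_ball V \<mu> x\<^sub>0 r"
    then have "r < d y"
      by (auto simp: graph_ball_def neighbours_def edges_def d_def)
    then show "\<mu> x y * ((-1) ^ d y * f (d y)) = 0"
      by (simp add: zero)
  qed (auto simp: fin)
  then have "(-1) ^ i * (\<Sum>y\<in>graph_ball V \<mu> x\<^sub>0 r. \<mu> x y * ((-1) ^ d y * f (d y)))
      = (\<Sum>y\<in>?N. (-1) ^ i * (\<mu> x y * ((-1) ^ d y * f (d y))))"
    by (simp add: sum_distrib_left)
  also have "\<dots> = (\<Sum>y\<in>?N. - f (Suc i) * \<mu> x y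
      - (f (i - 1) - f (Suc i)) * (if d y + 1 = d x then \<mu> x y else 0)
      + (f i + f (Suc i)) * (if d y = d x then \<mu> x y else 0))"
  proof (rule sum.cong)
    fix y assume "y \<in> ?N"
    then consider "d y + 1 = i" | "d y = i" | "d y = Suc i"
      using graph_dist_neighbour_cases[OF x0, of y x] unfolding d_def i by metis
    then show "(-1) ^ i * (\<mu> x y * ((-1) ^ d y * f (d y))) = - f (Suc i) * \<mu> x y
      - (f (i - 1) - f (Suc i)) * (if d y + 1 = d x then \<mu> x y else 0)
      + (f i + f (Suc i)) * (if d y = d x then \<mu> x y else 0)"
    proof cases
      case 1
      then show ?thesis
        unfolding dx by (auto simp: algebra_simps simp flip: power_add mult_2)
    next
      case 2
      then show ?thesis
        unfolding dx by (auto simp: algebra_simps simp flip: power_add mult_2)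
    next
      case 3
      then show ?thesis
        unfolding dx by (auto simp: algebra_simps simp flip: power_add mult_2)
    qed
  qed simp
  also have "\<dots> = - f (Suc i) * vertex_weight V \<mu> x - (f (i - 1) - f (Suc i)) * weight_minus V \<mu> x\<^sub>0 x
    + (f i + f (Suc i)) * weight_zero V \<mu> x\<^sub>0 x"
    unfolding vertex_weight_def weight_minus_def weight_zero_def d_def
    using fin by (simp only: sum.distrib sum_subtractf sum_distrib_left sum.inter_filter)
  finally show ?thesis .
qed

theorem theorem5p1:
  fixes V :: "'v set" and \<mu> :: "'v \<Rightarrow> 'v \<Rightarrow> real" and x\<^sub>0 :: 'v and r :: nat and l :: real
  assumes "weighted_graph V \<mu>" and "infinite V" and "x\<^sub>0 \<in> V" and "1 \<le> r"
    and "l = (SUP x\<in>graph_ball V \<mu> x\<^sub>0 r - {x\<^sub>0}. vertex_weight V \<mu> x / weight_minus V \<mu> x\<^sub>0 x)"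
    and "2 \<le> l"
  shows "lambda_max V \<mu> (graph_ball V \<mu> x\<^sub>0 r) \<ge>
           lambda_max UNIV (half_line l) (half_line_ball l r) - 2 * kappa V \<mu> x\<^sub>0 r"
proof -
  interpret weighted_graph V \<mu> by fact
  define k where "k = lambda_max UNIV (half_line l) (half_line_ball l r)"
  define \<kappa> where "\<kappa> = kappa V \<mu> x\<^sub>0 r"
  define d where "d = graph_dist V \<mu> x\<^sub>0"
  let ?B = "graph_ball V \<mu> x\<^sub>0 r" and ?m = "vertex_weight V \<mu>"
  have fin: "finite ?B"
    by (rule finite_graph_ball[OF assms(3)])
  have sub: "?B \<subseteq> V"
    by (auto simp: graph_ball_def)
  have pos: "0 < ?m x" if "x \<in> ?B" for x
    using vertex_weight_pos[OF assms(2)] that sub by blast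
  obtain f where f: "0 < f 0" "\<forall>i. 0 \<le> f i" "\<forall>i. f (Suc i) \<le> f i" "\<forall>i>r. f i = 0"
    and base: "f 0 + f 1 = k * f 0"
    and step: "\<forall>i<r. f (Suc i) + f i / l + (1 - 1 / l) * f (Suc (Suc i)) = k * f (Suc i)"
    unfolding k_def by (rule half_line_top_eigenfunction[OF assms(6)])
  note nonneg = f(2)[rule_format] and decr = f(3)[rule_format] and zero = f(4)[rule_format]
  define F where "F x = (- 1) ^ d x * f (d x)" for x
  have loops: "weight_zero V \<mu> x\<^sub>0 x / ?m x \<le> \<kappa>" if "x \<in> ?B" for x
    unfolding \<kappa>_def kappa_def by (rule cSUP_upper[OF that]) (simp add: fin)
  have inward: "1 / l \<le> weight_minus V \<mu> x\<^sub>0 x / ?m x" if x: "x \<in> ?B" "x \<noteq> x\<^sub>0" for x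
  proof -
    have "?m x / weight_minus V \<mu> x\<^sub>0 x \<le> l"
      unfolding assms(5) by (rule cSUP_upper) (use x fin in auto)
    moreover have "0 < weight_minus V \<mu> x\<^sub>0 x"
      using weight_minus_pos assms(3) x sub by blast
    ultimately show ?thesis
      using pos[OF x(1)] assms(6) by (simp add: field_simps)
  qed
  have pointwise: "(k - 2 * \<kappa>) * f (d x) \<le> (- 1) ^ d x * dirichlet_laplacian V \<mu> ?B F x"
    if x: "x \<in> ?B" for x
  proof -
    define p where "p = weight_minus V \<mu> x\<^sub>0 x / ?m x"
    define q where "q = weight_zero V \<mu> x\<^sub>0 x / ?m x"
    have m: "0 < ?m x"
      by (rule pos[OF x])
    have "0 \<le> q"
      unfolding q_def weight_zero_def using m
      by (intro divide_nonneg_pos sum_nonneg) (auto simp: neighbours_def edges_def)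
    then have "q * (f (d x) + f (Suc (d x))) \<le> \<kappa> * (2 * f (d x))"
      using loops[OF x] decr[of "d x"] nonneg[of "d x"] nonneg[of "Suc (d x)"]
      by (intro mult_mono) (auto simp: q_def)
    moreover have "(- 1) ^ d x * dirichlet_laplacian V \<mu> ?B F x =
        f (d x) + f (Suc (d x)) + p * (f (d x - 1) - f (Suc (d x))) - q * (f (d x) + f (Suc (d x)))"
    proof -
      have "(- 1) ^ d x * dirichlet_laplacian V \<mu> ?B F x =
          f (d x) - (1 / ?m x) * ((- 1) ^ d x * (\<Sum>y\<in>?B. \<mu> x y * F y))"
        unfolding dirichlet_laplacian_def F_def[of x]
        by (simp add: algebra_simps flip: power_add mult_2)
      also have "(- 1) ^ d x * (\<Sum>y\<in>?B. \<mu> x y * F y) =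
          - f (Suc (d x)) * ?m x - (f (d x - 1) - f (Suc (d x))) * weight_minus V \<mu> x\<^sub>0 x
          + (f (d x) + f (Suc (d x))) * weight_zero V \<mu> x\<^sub>0 x"
        unfolding F_def d_def
        by (rule sum_alternating_radial) (use assms(3) x sub zero in auto)
      also have "f (d x) - (1 / ?m x) * (- f (Suc (d x)) * ?m x
            - (f (d x - 1) - f (Suc (d x))) * weight_minus V \<mu> x\<^sub>0 x
            + (f (d x) + f (Suc (d x))) * weight_zero V \<mu> x\<^sub>0 x) =
          f (d x) + f (Suc (d x)) + p * (f (d x - 1) - f (Suc (d x))) - q * (f (d x) + f (Suc (d x)))"
        using m by (simp add: p_def q_def field_simps)
      finally show ?thesis .
    qed
    moreover have "k * f (d x) \<le> f (d x) + f (Suc (d x)) + p * (f (d x - 1) - f (Suc (d x)))"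
    proof (cases "x = x\<^sub>0")
      case True
      then have "d x = 0"
        by (simp add: d_def graph_dist_self)
      then have "p = 0"
        by (simp add: p_def weight_minus_def d_def)
      then show ?thesis
        using base \<open>d x = 0\<close> by simp
    next
      case False
      have "d x \<noteq> 0"
      proof
        assume "d x = 0"
        moreover have "(x\<^sub>0, x) \<in> edges V \<mu> ^^ d x"
          unfolding d_def using assms(3) x sub by (blast intro: graph_dist_walk)
        ultimately show False
          using False by simp
      qed
      then obtain i where i: "d x = Suc i"
        by (cases "d x") auto
      have "i < r"
        using x i by (simp add: graph_ball_def d_def)
      have "(1 / l) * (f i - f (Suc (Suc i))) \<le> p * (f i - f (Suc (Suc i)))"
        using inward[OF x False] decr[of i] decr[of "Suc i"]
        by (intro mult_right_mono) (auto simp: p_def)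
      then show ?thesis
        using step[rule_format, OF \<open>i < r\<close>] by (simp add: i algebra_simps)
    qed
    ultimately show ?thesis
      by (simp add: algebra_simps)
  qed
  have "k - 2 * \<kappa> \<le> lambda_max V \<mu> ?B"
  proof (rule lambda_max_ge_of_pointwise[OF fin sub _ pos, where F = F])
    show "\<exists>x\<in>?B. F x \<noteq> 0"
      using f assms(3)
      by (intro bexI[of _ x\<^sub>0]) (auto simp: F_def d_def graph_dist_self graph_ball_def)
    fix x assume x: "x \<in> ?B"
    have "(k - 2 * \<kappa>) * (F x)\<^sup>2 = ((k - 2 * \<kappa>) * f (d x)) * f (d x)"
      by (simp add: F_def power_mult_distrib power2_eq_square flip: power_add mult_2)
    also have "\<dots> \<le> ((- 1) ^ d x * dirichlet_laplacian V \<mu> ?B F x) * f (d x)"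
      by (rule mult_right_mono[OF pointwise[OF x] nonneg])
    also have "\<dots> = dirichlet_laplacian V \<mu> ?B F x * F x"
      by (simp add: F_def)
    finally show "(k - 2 * \<kappa>) * (F x)\<^sup>2 \<le> dirichlet_laplacian V \<mu> ?B F x * F x" .
  qed
  then show ?thesis
    by (simp add: k_def \<kappa>_def)
qed

end
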